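(* Let $X\in\mathbb{R}^{m\times n}$ with $m\ge n$ satisfy $$6n^2\mathbf{u}\,\kappa_2(X)<1,\qquad mn\mathbf{u}\le\tfrac1{64},\qquad n(n+1)\mathbf{u}\le\tfrac1{64},$$ and let the shift $s$ satisfy $$11\{mn+n(n+1)\}\mathbf{u}\|X\|_2^2\le s\le\tfrac1{100}\|X\|_2^2 .$$ Then one step of shiftedCholeskyQR with shift $s$ applied to $X$ in double precision arithmetic yields a computed $\hat Q$ with $$\kappa_2(\hat Q)\le 2\sqrt{1+\alpha\,(\kappa_2(X))^2}\cdot\sqrt3,\qquad\text{where } \sqrt\alpha=\frac{\sqrt s}{\|X\|_2}.$$
   Context: $\mathbf{u}$ is the unit roundoff ($\mathbf{u}=2^{-53}$ in IEEE double precision), and $\gamma_k:=\frac{k\mathbf{u}}{1-k\mathbf{u}}$. $|M|$ is the matrix of absolute values of the entries of $M$, and inequalities between matrices are entrywise. $\|\cdot\|_2$ is the spectral norm; for a matrix $M$ with $n$ columns and at least $n$ rows, $\kappa_2(M)=\|M\|_2/\sigma_n(M)$, where $\sigma_n(M)$ is its smallest singular value. Algorithm shiftedCholeskyQR for $X\in\mathbb{R}^{m\times n}$ with shift $s>0$: (1) $A=X^{\top}X$; (2) $R=\mathrm{chol}(A+sI)$, where $\mathrm{chol}(H)$ is the upper triangular Cholesky factor, $R^{\top}R=H$; (3) $Q=XR^{-1}$, computed row by row by triangular solves. Floating-point model (computed quantities carry hats): - $\hat A=X^{\top}X+E_1$ is symmetric, with $|E_1|\le\gamma_m|X|^{\top}|X|$.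 - $\hat R$ is upper triangular and nonsingular, $\hat R^{\top}\hat R=\hat A+sI+E_2$ with $|E_2|\le\gamma_{n+1}|\hat R|^{\top}|\hat R|$. A floating-point Cholesky factorization of a symmetric positive definite $n\times n$ matrix $H$ runs to completion whenever $\lambda_{\min}(H)\ge\sum_{i=1}^n\frac{\gamma_{i+1}}{1-\gamma_{i+1}}\|H\|_2$. - The $i$th row $\hat q_i^{\top}$ of $\hat Q$ satisfies $\hat q_i^{\top}(\hat R+\Delta\hat R_i)=x_i^{\top}$, where $x_i^{\top}$ is the $i$th row of $X$ and $|\Delta\hat R_i|\le\gamma_n|\hat R|$, for $i=1,\dots,m$. *)

theory Defs
  imports "HOL-Analysis.Analysis"
begin

(* A real m x n matrix has type real^'n^'m with m = CARD('m) and n = CARD('n).  On this type the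
   library's order and absolute value are entrywise: M \<le> N means \<forall>i j. M$i$j \<le> N$i$j, and \<bar>M\<bar>$i$j = \<bar>M$i$j\<bar>. *)

subsection \<open>Eigenvalues, singular values, condition number\<close>

definition eigenvalues :: "real^'n^'n \<Rightarrow> real set" where
  "eigenvalues H = {l. \<exists>v. v \<noteq> 0 \<and> H *v v = l *\<^sub>R v}"

definition lambda_min :: "real^'n^'n \<Rightarrow> real" where
  "lambda_min H = Min (eigenvalues H)"

definition singular_values :: "real^'n^'m \<Rightarrow> real set" where
  "singular_values M = sqrt ` eigenvalues (transpose M ** M)"

definition sigma_min :: "real^'n^'m \<Rightarrow> real" where
  "sigma_min M = Min (singular_values M)"

definition spectral_norm :: "real^'n^'m \<Rightarrow> real" where
  "spectral_norm M = onorm (\<lambda>v. M *v v)"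

(* Since x / 0 = 0 in HOL, a real-valued quotient would be 0 at rank-deficient matrices.  The value
   is therefore extended real, and infinite there (also at the zero matrix): a finite upper bound
   on cond2 M entails that M has full column rank. *)
definition cond2 :: "real^'n^'m \<Rightarrow> ereal" where
  "cond2 M = (if sigma_min M = 0 then \<infinity> else ereal (spectral_norm M / sigma_min M))"

definition symmetric_matrix :: "real^'n^'n \<Rightarrow> bool" where
  "symmetric_matrix H \<longleftrightarrow> transpose H = H"

definition pos_def_matrix :: "real^'n^'n \<Rightarrow> bool" where
  "pos_def_matrix H \<longleftrightarrow> symmetric_matrix H \<and> (\<forall>v. v \<noteq> 0 \<longrightarrow> v \<bullet> (H *v v) > 0)"

definition upper_triangular_matrix :: "real^('n::{finite,linorder})^('n::{finite,linorder}) \<Rightarrow> bool" where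
  "upper_triangular_matrix R \<longleftrightarrow> (\<forall>i j. j < i \<longrightarrow> R $ i $ j = 0)"

subsection \<open>Floating-point model\<close>

(* IEEE double precision *)
definition unit_roundoff :: real where
  "unit_roundoff = 1 / 2 ^ 53"

definition gam :: "nat \<Rightarrow> real" where
  "gam k = real k * unit_roundoff / (1 - real k * unit_roundoff)"

(* Each of the following relates the input of a floating-point computation to its possible
   computed results; beyond the error bounds nothing is assumed about the rounding errors. *)

definition fl_gram :: "real^'n^'m \<Rightarrow> real^'n^'n \<Rightarrow> bool" where
  "fl_gram X A \<longleftrightarrow> symmetric_matrix A \<and>
     (\<exists>E1. A = transpose X ** X + E1 \<and>
           \<bar>E1\<bar> \<le> gam CARD('m) *\<^sub>R (transpose \<bar>X\<bar> ** \<bar>X\<bar>))"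

(* The result None is a breakdown.  It is excluded only for those positive definite H for which
   the factorization is known to run to completion.  The error E2 also covers the rounding errors
   in forming the shifted diagonal of H. *)
definition fl_cholesky ::
    "real^('n::{finite,linorder})^('n::{finite,linorder})
      \<Rightarrow> (real^('n::{finite,linorder})^('n::{finite,linorder})) option \<Rightarrow> bool" where
  "fl_cholesky H res \<longleftrightarrow> (case res of
       None \<Rightarrow> \<not> (pos_def_matrix H \<and>
                  lambda_min H \<ge>
                    (\<Sum>i = 1..CARD('n). gam (i + 1) / (1 - gam (i + 1)) * spectral_norm H))
     | Some R \<Rightarrow> upper_triangular_matrix R \<and> invertible R \<and>
                 (\<exists>E2. transpose R ** R = H + E2 \<and>
                       \<bar>E2\<bar> \<le> gam (CARD('n) + 1) *\<^sub>R (transpose \<bar>R\<bar> ** \<bar>R\<bar>)))"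

(* Row-wise triangular solves for Q = X R^(-1); each row has its own backward error D. *)
definition fl_row_solve :: "real^'n^'m \<Rightarrow> real^'n^'n \<Rightarrow> real^'n^'m \<Rightarrow> bool" where
  "fl_row_solve X R Q \<longleftrightarrow>
     (\<forall>i. \<exists>D. row i Q v* (R + D) = row i X \<and> \<bar>D\<bar> \<le> gam CARD('n) *\<^sub>R \<bar>R\<bar>)"

(* One step of shiftedCholeskyQR; the result is None if the Cholesky factorization breaks down,
   and otherwise the pair of the computed factors Q and R. *)
definition fl_shifted_cholesky_qr ::
    "real^('n::{finite,linorder})^'m \<Rightarrow> real
      \<Rightarrow> ((real^('n::{finite,linorder})^'m) \<times> (real^('n::{finite,linorder})^('n::{finite,linorder}))) option
      \<Rightarrow> bool" where
  "fl_shifted_cholesky_qr X s res \<longleftrightarrow>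
     (\<exists>A chol. fl_gram X A \<and> fl_cholesky (A + s *\<^sub>R mat 1) chol \<and>
        (case chol of
           None \<Rightarrow> res = None
         | Some R \<Rightarrow> (\<exists>Q. fl_row_solve X R Q \<and> res = Some (Q, R))))"

end

theory Submission
  imports Defs
begin

text \<open>
  Write \<open>\<sigma>\<close> for the smallest singular value of \<open>X\<close>. The rounding errors of the Gram matrix and of
  the Cholesky factorization combine to \<open>R\<^sup>T R = X\<^sup>T X + s I + E\<close>. The lower bound on the shift is
  chosen so that \<open>\<parallel>E\<parallel> \<le> s / 10\<close> (lemmas \<open>fl_gram_error\<close> and \<open>fl_cholesky_error\<close>); in particular the
  shift keeps the factored matrix positive definite by a margin that excludes a breakdown (lemma
  \<open>fl_cholesky_completes\<close>). Read as an identity of quadratic forms, this gives for every \<open>v\<close>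
  \<open>\<parallel>X v\<parallel>\<^sup>2 \<le> \<parallel>R v\<parallel>\<^sup>2 \<le> \<parallel>X v\<parallel>\<^sup>2 + 1.1 s \<parallel>v\<parallel>\<^sup>2 \<le> 1.1 (1 + s / \<sigma>\<^sup>2) \<parallel>X v\<parallel>\<^sup>2\<close>,
  so that the exact quotient \<open>X R\<^sup>-\<^sup>1\<close> has norm at most 1 and condition number at most
  \<open>sqrt (1.1 * (1 + s / \<sigma>\<^sup>2))\<close>, where \<open>s / \<sigma>\<^sup>2 = \<alpha> \<kappa>\<^sub>2(X)\<^sup>2\<close>.

  The triangular solves replace this quotient by a matrix \<open>Q\<close> with \<open>Q R = X + D\<close>, where
  \<open>\<parallel>D\<parallel> \<le> \<sigma> \<parallel>Q\<parallel> / 5\<close>: the row errors add up to at most about \<open>n\<^sup>2 u \<parallel>Q\<parallel> \<parallel>R\<parallel>\<close>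
  (lemma \<open>fl_row_solve_residual\<close>), and \<open>6 n\<^sup>2 u \<kappa>\<^sub>2(X) < 1\<close> bounds this by a multiple of \<open>\<sigma>\<close>.
  Because \<open>\<sigma> \<parallel>v\<parallel> \<le> \<parallel>X v\<parallel>\<close>, the matrix \<open>D\<close> is a relative perturbation of \<open>X v\<close> for every \<open>v\<close>. It
  bounds \<open>\<parallel>Q\<parallel>\<close> by 5/4 and leaves at least 3/4 of \<open>\<parallel>X v\<parallel>\<close>, so it costs a factor 5/3 in the
  condition number (lemma \<open>cond2_of_perturbed_quotient\<close>). In total the constant is
  \<open>5/3 * sqrt 1.1\<close>, about 1.75, below \<open>2 * sqrt 3\<close>.

  The entrywise error bounds are turned into norm bounds through the Frobenius norm, which is the
  norm of the type \<open>real^'n^'m\<close> and is at most \<open>sqrt n\<close> times the spectral norm.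
\<close>

section \<open>Extreme eigenvalues of symmetric matrices\<close>

lemma symmetric_matrix_inner:
  fixes H :: "real^'n^'n"
  assumes "symmetric_matrix H"
  shows "v \<bullet> (H *v w) = (H *v v) \<bullet> w"
  by (metis assms dot_lmul_matrix symmetric_matrix_def transpose_matrix_vector)

lemma gram_inner:
  fixes M :: "real^'n^'m"
  shows "v \<bullet> ((transpose M ** M) *v w) = (M *v v) \<bullet> (M *v w)"
  by (metis dot_lmul_matrix matrix_vector_mul_assoc transpose_matrix_vector inner_commute)

lemma symmetric_gram: "symmetric_matrix (transpose M ** (M :: real^'n^'m))"
  by (simp add: symmetric_matrix_def matrix_transpose_mul)

text \<open>
  Eigenvectors of distinct eigenvalues are orthogonal, and an orthogonal set is finite. Finiteness
  is what makes the minimum in the definition of the least eigenvalue meaningful.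
\<close>

lemma finite_eigenvalues_symmetric:
  fixes H :: "real^'n^'n"
  assumes sym: "symmetric_matrix H"
  shows "finite (eigenvalues H)"
proof -
  define e where "e l = (SOME v. v \<noteq> 0 \<and> H *v v = l *\<^sub>R v)" for l
  have e: "e l \<noteq> 0" "H *v e l = l *\<^sub>R e l" if "l \<in> eigenvalues H" for l
    using someI_ex[of "\<lambda>v. v \<noteq> 0 \<and> H *v v = l *\<^sub>R v"] that
    by (auto simp: eigenvalues_def e_def)
  have orth: "e k \<bullet> e l = 0"
    if "k \<in> eigenvalues H" "l \<in> eigenvalues H" "k \<noteq> l" for k l
  proof -
    have "l * (e k \<bullet> e l) = k * (e k \<bullet> e l)"
      using symmetric_matrix_inner[OF sym, of "e k" "e l"] e that by simp
    with that show ?thesis by simp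
  qed
  have "inj_on e (eigenvalues H)"
    by (rule inj_onI) (metis e(1) inner_eq_zero_iff orth)
  moreover have "pairwise orthogonal (e ` eigenvalues H)"
    by (auto simp: pairwise_def orthogonal_def intro: orth)
  then have "finite (e ` eigenvalues H)"
    by (rule pairwise_orthogonal_imp_finite)
  ultimately show ?thesis
    using finite_image_iff by blast
qed

text \<open>
  A zero of a positive semidefinite form is a minimum, so the first-order term of the form along
  every line through it vanishes. Moving in the direction \<open>w = K v0\<close>, that term is twice the square
  of the norm of \<open>w\<close>.
\<close>

lemma psd_null_vector:
  fixes K :: "real^'n^'n"
  assumes sym: "symmetric_matrix K"
    and psd: "\<And>v. 0 \<le> v \<bullet> (K *v v)"
    and zero: "v0 \<bullet> (K *v v0) = 0"
  shows "K *v v0 = 0"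
proof (rule ccontr)
  define w where "w = K *v v0"
  assume "K *v v0 \<noteq> 0"
  then have a: "w \<bullet> w > 0" by (simp add: w_def)
  define b where "b = w \<bullet> (K *v w)"
  have b: "b \<ge> 0" using psd by (simp add: b_def)
  have expand: "(v0 + t *\<^sub>R w) \<bullet> (K *v (v0 + t *\<^sub>R w)) = t * (2 * (w \<bullet> w) + t * b)" for t
  proof -
    have "v0 \<bullet> (K *v w) = w \<bullet> w"
      using symmetric_matrix_inner[OF sym, of v0 w] by (simp add: w_def)
    moreover have "w \<bullet> (K *v v0) = w \<bullet> w" by (simp add: w_def)
    ultimately show ?thesis
      using zero
      by (simp add: matrix_vector_right_distrib matrix_vector_mult_scaleR inner_add_left
          inner_add_right b_def algebra_simps)
  qed
  \<comment> \<open>a step in direction \<open>-w\<close>, short enough for the linear term to outweigh the quadratic one\<close>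
  define t where "t = - (w \<bullet> w) / (b + 1)"
  have "t < 0" using a b by (simp add: t_def divide_simps)
  moreover have "2 * (w \<bullet> w) + t * b > 0"
  proof -
    have "(w \<bullet> w) * b / (b + 1) \<le> w \<bullet> w"
      using a b by (simp add: divide_simps)
    moreover have "t * b = - ((w \<bullet> w) * b / (b + 1))" by (simp add: t_def)
    ultimately show ?thesis using a by linarith
  qed
  ultimately have "t * (2 * (w \<bullet> w) + t * b) < 0"
    by (rule mult_neg_pos)
  with psd[of "v0 + t *\<^sub>R w"] expand[of t] show False by simp
qed

text \<open>
  The Rayleigh quotient attains its minimum \<open>l\<close> on the compact unit sphere. There the positive
  semidefinite form of \<open>H - l I\<close> vanishes, so the minimizer is an eigenvector.
\<close>

lemma ex_rayleigh_minimum: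
  fixes H :: "real^'n^'n"
  assumes sym: "symmetric_matrix H"
  obtains l where "l \<in> eigenvalues H" "\<And>v. l * (v \<bullet> v) \<le> v \<bullet> (H *v v)"
proof -
  have "continuous_on (sphere 0 1) (\<lambda>v :: real^'n. v \<bullet> (H *v v))"
    by (intro continuous_intros linear_continuous_on matrix_vector_mul_bounded_linear)
  moreover have "axis undefined 1 \<in> sphere (0 :: real^'n) 1" by simp
  then have "sphere (0 :: real^'n) 1 \<noteq> {}" by blast
  ultimately obtain v0 :: "real^'n" where v0: "norm v0 = 1"
    and least: "\<And>v. norm v = 1 \<Longrightarrow> v0 \<bullet> (H *v v0) \<le> v \<bullet> (H *v v)"
    using continuous_attains_inf[of "sphere 0 1" "\<lambda>v. v \<bullet> (H *v v)"] by auto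
  define l where "l = v0 \<bullet> (H *v v0)"
  have bound: "l * (v \<bullet> v) \<le> v \<bullet> (H *v v)" for v
  proof (cases "v = 0")
    case False
    have "l \<le> ((1 / norm v) *\<^sub>R v) \<bullet> (H *v ((1 / norm v) *\<^sub>R v))"
      unfolding l_def by (rule least) (simp add: False)
    also have "\<dots> = (v \<bullet> (H *v v)) / (v \<bullet> v)"
      by (simp add: matrix_vector_mult_scaleR dot_square_norm power2_eq_square)
    finally show ?thesis using False by (simp add: pos_le_divide_eq)
  qed simp
  define K where "K = H - l *\<^sub>R mat 1"
  have Kv: "K *v v = H *v v - l *\<^sub>R v" for v
    by (simp add: K_def matrix_vector_mult_diff_rdistrib flip: scaleR_matrix_vector_assoc)
  have "symmetric_matrix K"
    using sym by (auto simp: symmetric_matrix_def K_def transpose_def vec_eq_iff mat_def)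
  then have "K *v v0 = 0"
    by (rule psd_null_vector)
      (use bound v0 in \<open>auto simp: Kv inner_diff_right l_def dot_square_norm\<close>)
  then have "l \<in> eigenvalues H"
    using v0 by (auto simp: eigenvalues_def Kv intro!: exI[of _ v0])
  then show thesis using bound by (rule that)
qed

lemma lambda_min_in_eigenvalues:
  fixes H :: "real^'n^'n"
  assumes "symmetric_matrix H"
  shows "lambda_min H \<in> eigenvalues H"
  unfolding lambda_min_def
  using Min_in[OF finite_eigenvalues_symmetric[OF assms]] ex_rayleigh_minimum[OF assms]
  by (metis empty_iff)

lemma lambda_min_le_rayleigh:
  fixes H :: "real^'n^'n"
  assumes "symmetric_matrix H"
  shows "lambda_min H * (v \<bullet> v) \<le> v \<bullet> (H *v v)"
proof -
  obtain l where l: "l \<in> eigenvalues H" "\<And>v. l * (v \<bullet> v) \<le> v \<bullet> (H *v v)"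
    using ex_rayleigh_minimum[OF assms] by blast
  have "lambda_min H \<le> l"
    unfolding lambda_min_def by (rule Min_le[OF finite_eigenvalues_symmetric[OF assms] l(1)])
  then have "lambda_min H * (v \<bullet> v) \<le> l * (v \<bullet> v)"
    by (simp add: mult_right_mono)
  with l(2)[of v] show ?thesis by linarith
qed

lemma lambda_min_greatest:
  fixes H :: "real^'n^'n"
  assumes "symmetric_matrix H" and "\<And>v. c * (v \<bullet> v) \<le> v \<bullet> (H *v v)"
  shows "c \<le> lambda_min H"
proof -
  obtain v where v: "v \<noteq> 0" "H *v v = lambda_min H *\<^sub>R v"
    using lambda_min_in_eigenvalues[OF assms(1)] by (auto simp: eigenvalues_def)
  with assms(2)[of v] show ?thesis by (simp add: mult_le_cancel_right)
qed

lemma sigma_min_eq: "sigma_min M = sqrt (lambda_min (transpose M ** M))"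
  for M :: "real^'n^'m"
  unfolding sigma_min_def singular_values_def lambda_min_def
  by (rule mono_Min_commute[symmetric])
    (use lambda_min_in_eigenvalues[OF symmetric_gram, of M] in
      \<open>auto simp: mono_def finite_eigenvalues_symmetric symmetric_gram\<close>)

lemma sigma_min_le_norm: "sigma_min M * norm v \<le> norm (M *v v)"
  for M :: "real^'n^'m"
proof -
  have "sqrt (lambda_min (transpose M ** M) * (v \<bullet> v)) \<le> sqrt ((M *v v) \<bullet> (M *v v))"
    using lambda_min_le_rayleigh[OF symmetric_gram, of M v] by (simp add: gram_inner)
  then show ?thesis by (simp add: sigma_min_eq real_sqrt_mult norm_eq_sqrt_inner)
qed

lemma sigma_min_greatest:
  fixes M :: "real^'n^'m"
  assumes "0 \<le> c" and "\<And>v. c * norm v \<le> norm (M *v v)"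
  shows "c \<le> sigma_min M"
  unfolding sigma_min_eq
proof (rule real_le_rsqrt, rule lambda_min_greatest[OF symmetric_gram])
  fix v
  have "(c * norm v)\<^sup>2 \<le> (norm (M *v v))\<^sup>2"
    using assms by (intro power_mono) auto
  then show "c\<^sup>2 * (v \<bullet> v) \<le> v \<bullet> ((transpose M ** M) *v v)"
    by (simp add: gram_inner dot_square_norm power_mult_distrib)
qed

section \<open>Spectral and Frobenius norm\<close>

lemma norm_matrix_vector_le: "norm (M *v v) \<le> spectral_norm M * norm v"
  for M :: "real^'n^'m"
  unfolding spectral_norm_def by (rule onorm) simp

lemma spectral_norm_least:
  fixes M :: "real^'n^'m"
  assumes "\<And>v. norm (M *v v) \<le> c * norm v"
  shows "spectral_norm M \<le> c"
  unfolding spectral_norm_def by (rule onorm_le[OF assms])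

lemma spectral_norm_nonneg: "0 \<le> spectral_norm M"
  for M :: "real^'n^'m"
  unfolding spectral_norm_def by (rule onorm_pos_le) simp

text \<open>
  The norm of \<open>real^'n^'m\<close>, a Euclidean norm of Euclidean norms, is the Frobenius norm. It depends
  only on the absolute values of the entries, so entrywise error bounds carry over to it directly.
\<close>

lemma frobenius_square: "(norm M)\<^sup>2 = (\<Sum>i\<in>UNIV. \<Sum>j\<in>UNIV. (M $ i $ j)\<^sup>2)"
  for M :: "real^'n^'m"
  by (simp add: norm_vec_def L2_set_def sum_nonneg)

lemma frobenius_transpose: "norm (transpose M) = norm M"
  for M :: "real^'n^'m"
proof -
  have "(norm (transpose M))\<^sup>2 = (norm M)\<^sup>2"
    unfolding frobenius_square by (subst sum.swap) (simp add: transpose_def)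
  then show ?thesis by simp
qed

lemma frobenius_abs: "norm \<bar>M\<bar> = norm M"
  for M :: "real^'n^'m"
proof -
  have "(norm \<bar>M\<bar>)\<^sup>2 = (norm M)\<^sup>2"
    unfolding frobenius_square by (simp add: abs_vec_def)
  then show ?thesis by simp
qed

lemma frobenius_mono:
  fixes M N :: "real^'n^'m"
  assumes "\<bar>M\<bar> \<le> N"
  shows "norm M \<le> norm N"
proof (rule norm_le_componentwise_cart, rule norm_le_componentwise_cart)
  fix i j
  have "\<bar>M $ i $ j\<bar> \<le> N $ i $ j"
    using assms by (auto simp: less_eq_vec_def abs_vec_def)
  then show "norm (M $ i $ j) \<le> norm (N $ i $ j)" by simp
qed

lemma frobenius_matrix_vector: "norm (M *v v) \<le> norm M * norm v"
  for M :: "real^'n^'m"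
proof (rule power2_le_imp_le)
  have "(norm (M *v v))\<^sup>2 = (\<Sum>i\<in>UNIV. (M $ i \<bullet> v)\<^sup>2)"
    by (simp add: norm_vec_def L2_set_def sum_nonneg matrix_vector_mul_component)
  also have "\<dots> \<le> (\<Sum>i\<in>UNIV. (norm (M $ i) * norm v)\<^sup>2)"
    by (intro sum_mono) (metis Cauchy_Schwarz_ineq2 abs_ge_zero power2_abs power_mono)
  also have "\<dots> = (norm M * norm v)\<^sup>2"
    by (simp add: norm_vec_def[of M] L2_set_def sum_nonneg power_mult_distrib sum_distrib_right)
  finally show "(norm (M *v v))\<^sup>2 \<le> (norm M * norm v)\<^sup>2" .
qed simp

lemma frobenius_mult: "norm (A ** B) \<le> norm A * norm B"
  for A :: "real^'n^'m" and B :: "real^'k^'n"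
proof (rule power2_le_imp_le)
  have rows: "(A ** B) $ i = transpose B *v (A $ i)" for i
    by (simp add: vec_eq_iff matrix_matrix_mult_def vector_matrix_mult_def mult.commute)
  have "(norm (A ** B))\<^sup>2 = (\<Sum>i\<in>UNIV. (norm (transpose B *v (A $ i)))\<^sup>2)"
    by (simp only: norm_vec_def[of "A ** B"] L2_set_def rows) (simp add: sum_nonneg)
  also have "\<dots> \<le> (\<Sum>i\<in>UNIV. (norm B * norm (A $ i))\<^sup>2)"
    by (intro sum_mono power_mono)
      (metis frobenius_matrix_vector frobenius_transpose, simp)
  also have "\<dots> = (norm A * norm B)\<^sup>2"
    by (simp add: norm_vec_def[of A] L2_set_def sum_nonneg power_mult_distrib sum_distrib_left
        mult.commute)
  finally show "(norm (A ** B))\<^sup>2 \<le> (norm A * norm B)\<^sup>2" .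
qed simp

lemma frobenius_le_spectral: "(norm M)\<^sup>2 \<le> real CARD('n) * (spectral_norm M)\<^sup>2"
  for M :: "real^'n^'m"
proof -
  have "(norm M)\<^sup>2 = (\<Sum>j\<in>UNIV. \<Sum>i\<in>UNIV. (M $ i $ j)\<^sup>2)"
    unfolding frobenius_square by (rule sum.swap)
  also have "\<dots> = (\<Sum>j\<in>UNIV. (norm (M *v axis j 1))\<^sup>2)"
    by (simp add: norm_vec_def L2_set_def sum_nonneg matrix_vector_mult_basis column_def)
  also have "\<dots> \<le> (\<Sum>j\<in>(UNIV :: 'n set). (spectral_norm M)\<^sup>2)"
  proof (intro sum_mono power_mono)
    show "norm (M *v axis j 1) \<le> spectral_norm M" for j
      using norm_matrix_vector_le[of M "axis j 1"] by simp
  qed simp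
  finally show ?thesis by simp
qed

text \<open>
  The form in which both the Gram product and the Cholesky factorization bound their errors.
\<close>

lemma frobenius_abs_gram:
  fixes M :: "real^'n^'m"
  assumes "\<bar>E\<bar> \<le> g *\<^sub>R (transpose \<bar>M\<bar> ** \<bar>M\<bar>)" and "0 \<le> g"
  shows "norm E \<le> g * (real CARD('n) * (spectral_norm M)\<^sup>2)"
proof -
  have "norm E \<le> g * norm (transpose \<bar>M\<bar> ** \<bar>M\<bar>)"
    using frobenius_mono[OF assms(1)] assms(2) by simp
  also have "\<dots> \<le> g * (norm M)\<^sup>2"
    using frobenius_mult[of "transpose \<bar>M\<bar>" "\<bar>M\<bar>"] assms(2)
    by (intro mult_left_mono) (simp_all add: frobenius_transpose frobenius_abs power2_eq_square)
  also have "\<dots> \<le> g * (real CARD('n) * (spectral_norm M)\<^sup>2)"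
    by (intro mult_left_mono frobenius_le_spectral assms(2))
  finally show ?thesis .
qed

lemma inner_matrix_le: "\<bar>v \<bullet> (E *v v)\<bar> \<le> norm E * (v \<bullet> v)"
  for E :: "real^'n^'n"
proof -
  have "\<bar>v \<bullet> (E *v v)\<bar> \<le> norm v * norm (E *v v)"
    by (rule Cauchy_Schwarz_ineq2)
  also have "\<dots> \<le> norm v * (norm E * norm v)"
    by (intro mult_left_mono frobenius_matrix_vector) simp
  finally show ?thesis by (simp add: dot_square_norm power2_eq_square mult_ac)
qed

section \<open>Backward error of the computed factors\<close>

lemma unit_roundoff_pos: "0 < unit_roundoff"
  by (simp add: unit_roundoff_def)

lemma gam_nonneg: "real k * unit_roundoff \<le> 1 / 64 \<Longrightarrow> 0 \<le> gam k"
  using unit_roundoff_pos by (simp add: gam_def)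

lemma gam_le:
  assumes "real k * unit_roundoff \<le> 1 / 64"
  shows "gam k \<le> 64 / 63 * (real k * unit_roundoff)"
proof -
  define t where "t = real k * unit_roundoff"
  have t: "0 \<le> t" "t \<le> 1 / 64"
    using assms unit_roundoff_pos by (auto simp: t_def)
  then have "t * (64 * t) \<le> t * 1" by (intro mult_left_mono) auto
  with t have "t / (1 - t) \<le> 64 / 63 * t"
    by (simp add: divide_simps) (simp add: algebra_simps)
  then show ?thesis by (simp add: gam_def t_def)
qed

lemma gam_ratio_le:
  assumes "real k * unit_roundoff \<le> 1 / 64"
  shows "gam k / (1 - gam k) \<le> 32 / 31 * (real k * unit_roundoff)"
proof -
  define t where "t = real k * unit_roundoff"
  have t: "0 \<le> t" "t \<le> 1 / 64"
    using assms unit_roundoff_pos by (auto simp: t_def)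
  have "gam k / (1 - gam k) = t / (1 - 2 * t)"
    using t by (simp add: gam_def flip: t_def) (simp add: divide_simps)
  also have "\<dots> \<le> 32 / 31 * t"
  proof -
    have "t * (64 * t) \<le> t * 1" using t by (intro mult_left_mono) auto
    with t show ?thesis by (simp add: divide_simps) (simp add: algebra_simps)
  qed
  finally show ?thesis by (simp add: t_def)
qed

lemma spectral_norm_square_le:
  fixes M :: "real^'n^'m"
  assumes "0 \<le> b" and "\<And>v. (norm (M *v v))\<^sup>2 \<le> b * (v \<bullet> v)"
  shows "(spectral_norm M)\<^sup>2 \<le> b"
proof -
  have "norm (M *v v) \<le> sqrt b * norm v" for v
    using real_le_rsqrt[OF assms(2)[of v]] by (simp add: real_sqrt_mult norm_eq_sqrt_inner)
  then have "spectral_norm M \<le> sqrt b" by (rule spectral_norm_least)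
  then show ?thesis
    using power_mono[OF _ spectral_norm_nonneg, of M "sqrt b" 2] assms(1) by simp
qed

text \<open>
  Testing \<open>y = M\<^sup>T M v\<close> against itself moves one factor \<open>M\<close> to the other side of the inner product.
\<close>

lemma norm_gram_vector_le: "norm ((transpose M ** M) *v v) \<le> (spectral_norm M)\<^sup>2 * norm v"
  for M :: "real^'n^'m"
proof (cases "(transpose M ** M) *v v = 0")
  case False
  define y where "y = (transpose M ** M) *v v"
  have "norm y * norm y = (M *v y) \<bullet> (M *v v)"
    using gram_inner[of y M v] by (simp add: y_def dot_square_norm flip: power2_eq_square)
  also have "\<dots> \<le> norm (M *v y) * norm (M *v v)" by (rule norm_cauchy_schwarz)
  also have "\<dots> \<le> (spectral_norm M * norm y) * (spectral_norm M * norm v)"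
    by (intro mult_mono norm_matrix_vector_le) (auto simp: spectral_norm_nonneg)
  finally have "norm y * norm y \<le> norm y * ((spectral_norm M)\<^sup>2 * norm v)"
    by (simp add: power2_eq_square mult_ac)
  then show ?thesis using False by (simp add: y_def)
qed simp

lemma fl_gram_error:
  fixes X :: "real^'n^'m"
  assumes "fl_gram X A" and "real CARD('m) * unit_roundoff \<le> 1 / 64"
  obtains E where "A = transpose X ** X + E" "symmetric_matrix A"
    "norm E \<le> 64 / 63 * (real CARD('m) * real CARD('n) * unit_roundoff * (spectral_norm X)\<^sup>2)"
proof -
  obtain E where E: "A = transpose X ** X + E"
    "\<bar>E\<bar> \<le> gam CARD('m) *\<^sub>R (transpose \<bar>X\<bar> ** \<bar>X\<bar>)" and sym: "symmetric_matrix A"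
    using assms(1) by (auto simp: fl_gram_def)
  have "norm E \<le> gam CARD('m) * (real CARD('n) * (spectral_norm X)\<^sup>2)"
    by (rule frobenius_abs_gram[OF E(2) gam_nonneg[OF assms(2)]])
  also have "\<dots> \<le> (64 / 63 * (real CARD('m) * unit_roundoff)) * (real CARD('n) * (spectral_norm X)\<^sup>2)"
    by (intro mult_right_mono gam_le assms(2)) simp
  finally show thesis using that[OF E(1) sym] by (simp add: mult_ac)
qed

lemma fl_cholesky_completes:
  fixes H :: "real^('n::{finite,linorder})^('n::{finite,linorder})"
  assumes chol: "fl_cholesky H res" and sym: "symmetric_matrix H"
    and "0 < c" and lower: "\<And>v. c * (v \<bullet> v) \<le> v \<bullet> (H *v v)"
    and upper: "spectral_norm H \<le> h"
    and "(real CARD('n) + 1) * unit_roundoff \<le> 1 / 64"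
    and "32 / 31 * (real CARD('n) * (real CARD('n) + 1) * unit_roundoff * h) \<le> c"
  shows "res \<noteq> None"
proof
  assume "res = None"
  have "pos_def_matrix H"
    unfolding pos_def_matrix_def
  proof (intro conjI sym allI impI)
    fix v :: "real^('n::{finite,linorder})" assume "v \<noteq> 0"
    then have "0 < c * (v \<bullet> v)" using \<open>0 < c\<close> by simp
    with lower[of v] show "0 < v \<bullet> (H *v v)" by linarith
  qed
  moreover have "(\<Sum>i = 1..CARD('n). gam (i + 1) / (1 - gam (i + 1)) * spectral_norm H) \<le> lambda_min H"
  proof -
    have "(\<Sum>i = 1..CARD('n). gam (i + 1) / (1 - gam (i + 1)) * spectral_norm H)
        \<le> (\<Sum>i = 1..CARD('n). 32 / 31 * ((real CARD('n) + 1) * unit_roundoff) * h)"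
    proof (intro sum_mono mult_mono upper)
      fix i assume "i \<in> {1..CARD('n)}"
      then have le: "real (i + 1) * unit_roundoff \<le> (real CARD('n) + 1) * unit_roundoff"
        using unit_roundoff_pos by (intro mult_right_mono) auto
      with gam_ratio_le[of "i + 1"] assms(6)
      show "gam (i + 1) / (1 - gam (i + 1)) \<le> 32 / 31 * ((real CARD('n) + 1) * unit_roundoff)"
        by linarith
    qed (use unit_roundoff_pos spectral_norm_nonneg in auto)
    also have "\<dots> \<le> c" using assms(7) by (simp add: mult_ac)
    also have "c \<le> lambda_min H" by (rule lambda_min_greatest[OF sym lower])
    finally show ?thesis .
  qed
  ultimately show False using chol \<open>res = None\<close> by (simp add: fl_cholesky_def)
qed

text \<open>
  The error bound refers to the computed factor \<open>R\<close> itself, whose size has to be controlled through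
  the same factorization: \<open>\<parallel>E\<parallel> \<le> \<parallel>R\<parallel>\<^sup>2 / 63\<close> and \<open>\<parallel>R\<parallel>\<^sup>2 \<le> h + \<parallel>E\<parallel>\<close> together bound \<open>\<parallel>R\<parallel>\<^sup>2\<close> by
  a multiple of \<open>h\<close>.
\<close>

lemma fl_cholesky_error:
  fixes H :: "real^('n::{finite,linorder})^('n::{finite,linorder})"
  assumes chol: "fl_cholesky H (Some R)" and "0 \<le> h"
    and upper: "\<And>v. v \<bullet> (H *v v) \<le> h * (v \<bullet> v)"
    and small: "real CARD('n) * (real CARD('n) + 1) * unit_roundoff \<le> 1 / 64"
  obtains E where "invertible R" "transpose R ** R = H + E"
    "(spectral_norm R)\<^sup>2 \<le> 63 / 62 * h"
    "norm E \<le> 32 / 31 * (real CARD('n) * (real CARD('n) + 1) * unit_roundoff * h)"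
proof -
  define n where "n = real CARD('n)"
  define t where "t = n * (n + 1) * unit_roundoff"
  obtain E where inv: "invertible R" and RR: "transpose R ** R = H + E"
    and E: "\<bar>E\<bar> \<le> gam (CARD('n) + 1) *\<^sub>R (transpose \<bar>R\<bar> ** \<bar>R\<bar>)"
    using chol by (auto simp: fl_cholesky_def)
  have n: "1 \<le> n" by (simp add: n_def Suc_leI)
  have "(n + 1) * unit_roundoff \<le> n * (n + 1) * unit_roundoff"
    using mult_right_mono[of 1 n "(n + 1) * unit_roundoff"] n unit_roundoff_pos
    by (simp add: mult.assoc)
  also have "\<dots> \<le> 1 / 64" using small by (simp add: n_def)
  finally have nu: "real (CARD('n) + 1) * unit_roundoff \<le> 1 / 64"
    by (simp add: n_def add.commute)
  have "norm E \<le> gam (CARD('n) + 1) * (n * (spectral_norm R)\<^sup>2)"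
    unfolding n_def by (rule frobenius_abs_gram[OF E gam_nonneg[OF nu]])
  also have "\<dots> \<le> (64 / 63 * (real (CARD('n) + 1) * unit_roundoff)) * (n * (spectral_norm R)\<^sup>2)"
    using n by (intro mult_right_mono gam_le nu) auto
  finally have E_le: "norm E \<le> 64 / 63 * t * (spectral_norm R)\<^sup>2"
    by (simp add: t_def n_def algebra_simps)
  have "t \<le> 1 / 64" using small by (simp add: t_def n_def)
  then have "64 / 63 * t \<le> 1 / 63" by simp
  then have E_le': "norm E \<le> 1 / 63 * (spectral_norm R)\<^sup>2"
    using E_le mult_right_mono[of "64 / 63 * t" "1 / 63" "(spectral_norm R)\<^sup>2"] by simp
  have "(spectral_norm R)\<^sup>2 \<le> h + norm E"
  proof (rule spectral_norm_square_le)
    fix v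
    have "(norm (R *v v))\<^sup>2 = v \<bullet> ((H + E) *v v)"
      using gram_inner[of v R v] by (simp add: RR dot_square_norm)
    also have "\<dots> = v \<bullet> (H *v v) + v \<bullet> (E *v v)"
      by (simp add: matrix_vector_mult_add_rdistrib inner_add_right)
    also have "\<dots> \<le> (h + norm E) * (v \<bullet> v)"
      using upper[of v] inner_matrix_le[of v E] by (simp add: algebra_simps)
    finally show "(norm (R *v v))\<^sup>2 \<le> (h + norm E) * (v \<bullet> v)" .
  qed (use \<open>0 \<le> h\<close> in simp)
  with E_le' have R_le: "(spectral_norm R)\<^sup>2 \<le> 63 / 62 * h" by simp
  have "64 / 63 * t * (spectral_norm R)\<^sup>2 \<le> 64 / 63 * t * (63 / 62 * h)"
    using R_le n unit_roundoff_pos by (intro mult_left_mono) (auto simp: t_def)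
  also have "\<dots> = 32 / 31 * (t * h)" by simp
  finally have "norm E \<le> 32 / 31 * (t * h)" using E_le by linarith
  with that[OF inv RR R_le] show thesis by (simp add: t_def n_def)
qed

text \<open>
  Each row is solved with its own perturbed triangular matrix, but all these perturbations have the
  same entrywise bound, so the residual as a whole is at most a multiple of \<open>|Q| |R|\<close>.
\<close>

lemma fl_row_solve_residual:
  fixes X Q :: "real^'n^'m" and R :: "real^'n^'n"
  assumes solve: "fl_row_solve X R Q" and small: "real CARD('n) * unit_roundoff \<le> 1 / 64"
  shows "norm (Q ** R - X)
    \<le> 64 / 63 * (real CARD('n) ^ 2 * unit_roundoff * spectral_norm Q * spectral_norm R)"
proof -
  define g where "g = gam CARD('n)"
  have g: "0 \<le> g" unfolding g_def by (rule gam_nonneg[OF small])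
  have "\<bar>Q ** R - X\<bar> \<le> g *\<^sub>R (\<bar>Q\<bar> ** \<bar>R\<bar>)"
    unfolding less_eq_vec_def
  proof (intro allI)
    fix i j
    obtain D where D: "row i Q v* (R + D) = row i X" "\<bar>D\<bar> \<le> g *\<^sub>R \<bar>R\<bar>"
      using solve by (auto simp: fl_row_solve_def g_def)
    have "X $ i $ j = (\<Sum>k\<in>UNIV. Q $ i $ k * R $ k $ j) + (\<Sum>k\<in>UNIV. Q $ i $ k * D $ k $ j)"
      using arg_cong[OF D(1), of "\<lambda>v. v $ j"]
      by (simp add: row_def vector_matrix_mult_def algebra_simps sum.distrib)
    then have "\<bar>(Q ** R - X) $ i $ j\<bar> = \<bar>\<Sum>k\<in>UNIV. Q $ i $ k * D $ k $ j\<bar>"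
      by (simp add: matrix_matrix_mult_def)
    also have "\<dots> \<le> (\<Sum>k\<in>UNIV. \<bar>Q $ i $ k\<bar> * (g * \<bar>R $ k $ j\<bar>))"
      by (rule order_trans[OF sum_abs])
        (use D(2) in \<open>auto intro!: sum_mono mult_left_mono simp: abs_mult less_eq_vec_def abs_vec_def\<close>)
    finally show "\<bar>Q ** R - X\<bar> $ i $ j \<le> (g *\<^sub>R (\<bar>Q\<bar> ** \<bar>R\<bar>)) $ i $ j"
      by (simp add: matrix_matrix_mult_def abs_vec_def sum_distrib_left mult_ac)
  qed
  then have "norm (Q ** R - X) \<le> g * norm (\<bar>Q\<bar> ** \<bar>R\<bar>)"
    using frobenius_mono g by fastforce
  also have "\<dots> \<le> g * (norm Q * norm R)"
    by (intro mult_left_mono[OF _ g]) (metis frobenius_mult frobenius_abs)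
  also have "norm Q * norm R \<le> real CARD('n) * (spectral_norm Q * spectral_norm R)"
  proof (rule power2_le_imp_le)
    have "(norm Q * norm R)\<^sup>2
        \<le> (real CARD('n) * (spectral_norm Q)\<^sup>2) * (real CARD('n) * (spectral_norm R)\<^sup>2)"
      unfolding power_mult_distrib by (intro mult_mono frobenius_le_spectral) auto
    then show "(norm Q * norm R)\<^sup>2 \<le> (real CARD('n) * (spectral_norm Q * spectral_norm R))\<^sup>2"
      by (simp add: power2_eq_square mult_ac)
  qed (simp add: spectral_norm_nonneg)
  finally have "norm (Q ** R - X) \<le> g * (real CARD('n) * (spectral_norm Q * spectral_norm R))"
    using g by (simp add: mult_left_mono)
  also have "\<dots> \<le> (64 / 63 * (real CARD('n) * unit_roundoff))
      * (real CARD('n) * (spectral_norm Q * spectral_norm R))"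
    unfolding g_def by (intro mult_right_mono gam_le small) (simp add: spectral_norm_nonneg)
  finally show ?thesis by (simp add: power2_eq_square mult_ac)
qed

section \<open>Conditioning of the computed orthogonal factor\<close>

lemma cond2_le:
  fixes M :: "real^'n^'m"
  assumes "0 < c" and "\<And>w. c * norm w \<le> norm (M *v w)" and "spectral_norm M \<le> C"
  shows "cond2 M \<le> ereal (C / c)"
proof -
  have c: "c \<le> sigma_min M" using assms by (intro sigma_min_greatest) auto
  have "spectral_norm M / sigma_min M \<le> C / c"
    using assms c spectral_norm_nonneg[of M] by (intro frac_le) auto
  then show ?thesis using c assms(1) by (simp add: cond2_def)
qed

text \<open>
  Every vector \<open>w\<close> is \<open>R v\<close> for some \<open>v\<close>, so the size of \<open>Q w\<close> relative to \<open>w\<close> can be read off from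
  \<open>Q R v\<close>, which is \<open>X v\<close> up to the residual. The residual bound involves the unknown norm of
  \<open>Q\<close>; it is first solved for that norm.
\<close>

lemma cond2_of_perturbed_quotient:
  fixes X Q :: "real^'n^'m" and R :: "real^'n^'n"
  defines "\<sigma> \<equiv> sigma_min X"
  assumes sigma: "0 < \<sigma>" and s: "0 < s" and inv: "invertible R"
    and R_lower: "\<And>v. norm (X *v v) \<le> norm (R *v v)"
    and R_upper: "\<And>v. (norm (R *v v))\<^sup>2 \<le> (norm (X *v v))\<^sup>2 + 11 / 10 * s * (norm v)\<^sup>2"
    and residual: "norm (Q ** R - X) \<le> \<sigma> * spectral_norm Q / 5"
  shows "cond2 Q \<le> ereal (2 * sqrt (1 + s / \<sigma>\<^sup>2) * sqrt 3)"
proof -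
  define q where "q = spectral_norm Q"
  \<comment> \<open>bound on the condition number of the exact quotient\<close>
  define L where "L = sqrt (11 / 10) * sqrt (1 + s / \<sigma>\<^sup>2)"
  have L: "0 < L" using s sigma by (simp add: L_def add_pos_nonneg)
  have sigma_le: "\<sigma> * norm v \<le> norm (X *v v)" for v
    unfolding \<sigma>_def by (rule sigma_min_le_norm)
  have split: "Q *v (R *v v) = X *v v + (Q ** R - X) *v v" for v
    by (simp add: matrix_vector_mul_assoc matrix_vector_mult_diff_rdistrib)
  have residual_le: "norm ((Q ** R - X) *v v) \<le> q / 5 * norm (X *v v)" for v
  proof -
    have "norm ((Q ** R - X) *v v) \<le> norm (Q ** R - X) * norm v"
      by (rule frobenius_matrix_vector)
    also have "\<dots> \<le> (\<sigma> * q / 5) * norm v"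
      unfolding q_def by (intro mult_right_mono residual) simp
    also have "\<dots> = q / 5 * (\<sigma> * norm v)" by simp
    also have "\<dots> \<le> q / 5 * norm (X *v v)"
      by (intro mult_left_mono sigma_le) (simp add: q_def spectral_norm_nonneg)
    finally show ?thesis .
  qed
  have surj: "\<exists>v. w = R *v v" for w
    using inv by (metis invertible_def matrix_vector_mul_assoc matrix_vector_mul_lid)
  have "q \<le> 1 + q / 5"
    unfolding q_def
  proof (rule spectral_norm_least, fold q_def)
    fix w
    obtain v where w: "w = R *v v" using surj by blast
    have "norm (Q *v w) \<le> norm (X *v v) + norm ((Q ** R - X) *v v)"
      unfolding w split by (rule norm_triangle_ineq)
    also have "\<dots> \<le> (1 + q / 5) * norm (X *v v)"
      using residual_le[of v] by (simp add: algebra_simps)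
    also have "\<dots> \<le> (1 + q / 5) * norm w"
      unfolding w by (intro mult_left_mono R_lower) (simp add: q_def spectral_norm_nonneg)
    finally show "norm (Q *v w) \<le> (1 + q / 5) * norm w" .
  qed
  then have q: "q \<le> 5 / 4" by simp
  have R_le: "norm (R *v v) \<le> L * norm (X *v v)" for v
  proof (rule power2_le_imp_le)
    have "(\<sigma> * norm v)\<^sup>2 \<le> (norm (X *v v))\<^sup>2"
      using sigma_le[of v] sigma by (intro power_mono) auto
    then have "(norm v)\<^sup>2 \<le> (norm (X *v v))\<^sup>2 / \<sigma>\<^sup>2"
      using sigma by (simp add: power_mult_distrib pos_le_divide_eq mult.commute)
    then have "11 / 10 * s * (norm v)\<^sup>2 \<le> 11 / 10 * s * ((norm (X *v v))\<^sup>2 / \<sigma>\<^sup>2)"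
      using s by (intro mult_left_mono) auto
    moreover have "(L * norm (X *v v))\<^sup>2
        = 11 / 10 * (norm (X *v v))\<^sup>2 + 11 / 10 * s * ((norm (X *v v))\<^sup>2 / \<sigma>\<^sup>2)"
      using s by (simp add: L_def power_mult_distrib algebra_simps)
    moreover have "0 \<le> (norm (X *v v))\<^sup>2" by simp
    ultimately show "(norm (R *v v))\<^sup>2 \<le> (L * norm (X *v v))\<^sup>2"
      using R_upper[of v] by linarith
  qed (use L in simp)
  have lower: "3 / (4 * L) * norm w \<le> norm (Q *v w)" for w
  proof -
    obtain v where w: "w = R *v v" using surj by blast
    have "q / 5 * norm (X *v v) \<le> 1 / 4 * norm (X *v v)"
      using q by (intro mult_right_mono) auto
    then have "3 / 4 * norm (X *v v) \<le> norm (X *v v) - norm ((Q ** R - X) *v v)"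
      using residual_le[of v] by linarith
    also have "\<dots> \<le> norm (Q *v w)"
      unfolding w split by (rule norm_diff_ineq)
    finally have "3 / 4 * norm (X *v v) \<le> norm (Q *v w)" .
    moreover have "3 / (4 * L) * norm w \<le> 3 / 4 * norm (X *v v)"
      using R_le[of v] L by (simp add: w divide_simps mult_ac)
    ultimately show ?thesis by linarith
  qed
  have "cond2 Q \<le> ereal (5 / 4 / (3 / (4 * L)))"
    using L q by (intro cond2_le lower) (auto simp: q_def)
  also have "5 / 4 / (3 / (4 * L)) = (5 / 3 * sqrt (11 / 10)) * sqrt (1 + s / \<sigma>\<^sup>2)"
    using L by (simp add: L_def)
  also have "\<dots> \<le> (2 * sqrt 3) * sqrt (1 + s / \<sigma>\<^sup>2)"
  proof (intro mult_right_mono)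
    have "sqrt (11 / 10) \<le> sqrt 3" by simp
    then show "5 / 3 * sqrt (11 / 10) \<le> 2 * sqrt 3"
      using real_sqrt_ge_zero[of 3] by linarith
  qed (use s in simp)
  finally show ?thesis by (simp add: mult_ac)
qed

theorem theorem3p3:
  fixes X :: "real^('n::{finite,linorder})^'m"
    and s \<alpha> m n :: real
    and res :: "((real^('n::{finite,linorder})^'m) \<times> (real^('n::{finite,linorder})^('n::{finite,linorder}))) option"
  assumes "m = real CARD('m)" and "n = real CARD('n)"
    and "CARD('m) \<ge> CARD('n)"
    and "ereal (6 * n^2 * unit_roundoff) * cond2 X < 1"
    and "m * n * unit_roundoff \<le> 1 / 64"
    and "n * (n + 1) * unit_roundoff \<le> 1 / 64"
    and "s > 0"
    and "11 * (m * n + n * (n + 1)) * unit_roundoff * (spectral_norm X)^2 \<le> s"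
    and "s \<le> 1 / 100 * (spectral_norm X)^2"
    and "sqrt \<alpha> = sqrt s / spectral_norm X"
    and "fl_shifted_cholesky_qr X s res"
  shows "\<exists>Q R. res = Some (Q, R) \<and>
           cond2 Q \<le> ereal (2 * sqrt (1 + \<alpha> * (real_of_ereal (cond2 X))^2) * sqrt 3)"
proof -
  define u where "u = unit_roundoff"
  define N where "N = spectral_norm X"
  define \<sigma> where "\<sigma> = sigma_min X"
  \<comment> \<open>the first-order error scales of the Gram product and of the Cholesky factorization\<close>
  define p where "p = m * n * u * N\<^sup>2"
  define r where "r = n * (n + 1) * u * N\<^sup>2"
  have u: "0 < u" unfolding u_def by (rule unit_roundoff_pos)
  have m: "1 \<le> m" and n: "1 \<le> n" by (simp_all add: assms(1,2) Suc_leI)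
  have "N \<noteq> 0" using assms(7,9) by (auto simp: N_def)
  then have N: "0 < N" using spectral_norm_nonneg[of X] by (simp add: N_def less_le)
  have "1 * (m * u) \<le> n * (m * u)" using m n u by (intro mult_right_mono) auto
  then have mu: "m * u \<le> 1 / 64" using assms(5) by (simp add: u_def mult_ac)
  have "(n + 1) * u \<le> n * (n + 1) * u"
    using mult_right_mono[of 1 n "(n + 1) * u"] n u by (simp add: mult.assoc)
  also have "\<dots> \<le> 1 / 64" using assms(6) by (simp add: u_def)
  finally have n1u: "(n + 1) * u \<le> 1 / 64" .
  then have nu: "n * u \<le> 1 / 64" using u by (simp add: algebra_simps)
  have p: "0 \<le> p" "p \<le> 1 / 64 * N\<^sup>2"
    using mult_right_mono[OF assms(5), of "N\<^sup>2"] m n u by (auto simp: p_def u_def)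
  have r: "0 \<le> r" using n u by (simp add: r_def)
  have s: "11 * (p + r) \<le> s" "s \<le> 1 / 100 * N\<^sup>2"
    using assms(8,9) by (simp_all add: p_def r_def u_def N_def algebra_simps)

  have sigma: "0 < \<sigma>" and sigma_le: "6 * n\<^sup>2 * u * N \<le> \<sigma>"
    and kappa: "cond2 X = ereal (N / \<sigma>)"
  proof -
    define k where "k = 6 * n\<^sup>2 * unit_roundoff"
    have "0 < k" using n u by (simp add: k_def u_def)
    moreover have "ereal k * cond2 X < 1" using assms(4) by (simp add: k_def)
    ultimately have "cond2 X \<noteq> \<infinity>" by auto
    then have "\<sigma> \<noteq> 0" by (auto simp: cond2_def \<sigma>_def)
    moreover have "0 \<le> \<sigma>"
      unfolding \<sigma>_def by (rule sigma_min_greatest) auto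
    ultimately show "0 < \<sigma>" by simp
    show "cond2 X = ereal (N / \<sigma>)" using \<open>\<sigma> \<noteq> 0\<close> by (simp add: cond2_def \<sigma>_def N_def)
    with assms(4) have "6 * n\<^sup>2 * u * (N / \<sigma>) < 1" by (simp add: u_def)
    with \<open>0 < \<sigma>\<close> show "6 * n\<^sup>2 * u * N \<le> \<sigma>" by (simp add: pos_divide_less_eq)
  qed

  obtain A chol where A: "fl_gram X A" and chol: "fl_cholesky (A + s *\<^sub>R mat 1) chol"
    and res: "case chol of None \<Rightarrow> res = None
         | Some R \<Rightarrow> (\<exists>Q. fl_row_solve X R Q \<and> res = Some (Q, R))"
    using assms(11) unfolding fl_shifted_cholesky_qr_def by blast
  define H where "H = A + s *\<^sub>R mat 1"
  obtain E1 where E1: "A = transpose X ** X + E1" "symmetric_matrix A" "norm E1 \<le> 64 / 63 * p"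
    using fl_gram_error[OF A] mu by (auto simp: p_def u_def N_def assms(1,2))
  have Hv: "H *v v = (transpose X ** X) *v v + E1 *v v + s *\<^sub>R v" for v
    by (simp add: H_def E1(1) matrix_vector_mult_add_rdistrib flip: scaleR_matrix_vector_assoc)
  have quad: "v \<bullet> (H *v v) = (norm (X *v v))\<^sup>2 + v \<bullet> (E1 *v v) + s * (v \<bullet> v)" for v
    by (simp add: Hv inner_add_right gram_inner dot_square_norm)
  have symH: "symmetric_matrix H"
    using E1(2) by (auto simp: symmetric_matrix_def H_def transpose_def vec_eq_iff mat_def)
  \<comment> \<open>\<open>\<parallel>E1\<parallel> \<le> N\<^sup>2 / 63\<close> and \<open>s \<le> N\<^sup>2 / 100\<close> leave room below 103/100\<close>
  define h where "h = 103 / 100 * N\<^sup>2"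
  have h: "N\<^sup>2 + norm E1 + s \<le> h" using E1(3) p s by (simp add: h_def)
  have H_norm: "spectral_norm H \<le> h"
  proof (rule spectral_norm_least)
    fix v
    have "norm (H *v v) \<le> norm ((transpose X ** X) *v v) + norm (E1 *v v) + norm (s *\<^sub>R v)"
      unfolding Hv by (meson add_right_mono norm_triangle_ineq order_trans)
    also have "\<dots> \<le> N\<^sup>2 * norm v + norm E1 * norm v + s * norm v"
      unfolding N_def using assms(7)
      by (intro add_mono norm_gram_vector_le frobenius_matrix_vector) simp
    also have "\<dots> \<le> h * norm v"
      using mult_right_mono[OF h, of "norm v"] by (simp add: algebra_simps)
    finally show "norm (H *v v) \<le> h * norm v" .
  qed
  have "chol \<noteq> None"
  proof (rule fl_cholesky_completes[OF chol[folded H_def] symH])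
    show "0 < s / 2" using assms(7) by simp
    show "s / 2 * (v \<bullet> v) \<le> v \<bullet> (H *v v)" for v
    proof -
      have "norm E1 * (v \<bullet> v) \<le> s / 2 * (v \<bullet> v)"
        using E1(3) s p r by (intro mult_right_mono) auto
      then show ?thesis
        using inner_matrix_le[of v E1] quad[of v] zero_le_power2[of "norm (X *v v)"] by linarith
    qed
    show "spectral_norm H \<le> h" by (rule H_norm)
    show "(real CARD('n) + 1) * unit_roundoff \<le> 1 / 64"
      using n1u by (simp add: assms(2) u_def)
    have "32 / 31 * (n * (n + 1) * u * h) = 32 / 31 * (103 / 100 * r)" by (simp add: r_def h_def)
    also have "\<dots> \<le> s / 2" using s p r by simp
    finally show "32 / 31 * (real CARD('n) * (real CARD('n) + 1) * unit_roundoff * h) \<le> s / 2"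
      by (simp add: assms(2) u_def)
  qed
  then obtain R Q where R: "chol = Some R" and Q: "fl_row_solve X R Q" "res = Some (Q, R)"
    using res by auto
  obtain E2 where inv: "invertible R" and RR: "transpose R ** R = H + E2"
    and R_norm: "(spectral_norm R)\<^sup>2 \<le> 63 / 62 * h" and E2: "norm E2 \<le> 32 / 31 * (103 / 100 * r)"
  proof (rule fl_cholesky_error[OF chol[folded H_def, unfolded R]])
    show "0 \<le> h" by (simp add: h_def)
    show "v \<bullet> (H *v v) \<le> h * (v \<bullet> v)" for v
    proof -
      have "v \<bullet> (H *v v) \<le> norm v * norm (H *v v)" by (rule norm_cauchy_schwarz)
      also have "\<dots> \<le> norm v * (h * norm v)"
        using norm_matrix_vector_le[of H v] mult_right_mono[OF H_norm, of "norm v"]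
        by (intro mult_left_mono) auto
      finally show ?thesis by (simp add: dot_square_norm power2_eq_square mult_ac)
    qed
    show "real CARD('n) * (real CARD('n) + 1) * unit_roundoff \<le> 1 / 64"
      using assms(2,6) by simp
  qed (use that in \<open>simp add: r_def h_def u_def assms(2)\<close>)

  \<comment> \<open>both errors are below \<open>1.1 * (p + r)\<close>, a tenth of the least admissible shift\<close>
  have err: "\<bar>v \<bullet> (E1 *v v) + v \<bullet> (E2 *v v)\<bar> \<le> s / 10 * (v \<bullet> v)" for v
  proof -
    have "(norm E1 + norm E2) * (v \<bullet> v) \<le> s / 10 * (v \<bullet> v)"
      using E1(3) E2 s p r by (intro mult_right_mono) auto
    then show ?thesis
      using inner_matrix_le[of v E1] inner_matrix_le[of v E2]
        abs_triangle_ineq[of "v \<bullet> (E1 *v v)" "v \<bullet> (E2 *v v)"]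
      unfolding distrib_right by linarith
  qed
  have Rv: "(norm (R *v v))\<^sup>2
      = (norm (X *v v))\<^sup>2 + s * (v \<bullet> v) + (v \<bullet> (E1 *v v) + v \<bullet> (E2 *v v))" for v
    using gram_inner[of v R v]
    by (simp add: RR matrix_vector_mult_add_rdistrib inner_add_right quad dot_square_norm)
  have "cond2 Q \<le> ereal (2 * sqrt (1 + s / \<sigma>\<^sup>2) * sqrt 3)"
    unfolding \<sigma>_def
  proof (rule cond2_of_perturbed_quotient[OF _ assms(7) inv])
    show "0 < sigma_min X" using sigma by (simp add: \<sigma>_def)
    show "norm (X *v v) \<le> norm (R *v v)" for v
    proof (rule power2_le_imp_le)
      have "0 \<le> s * (v \<bullet> v)" using assms(7) by simp
      then show "(norm (X *v v))\<^sup>2 \<le> (norm (R *v v))\<^sup>2"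
        using Rv[of v] err[of v] by linarith
    qed simp
    show "(norm (R *v v))\<^sup>2 \<le> (norm (X *v v))\<^sup>2 + 11 / 10 * s * (norm v)\<^sup>2" for v
      using Rv[of v] err[of v] abs_ge_self[of "v \<bullet> (E1 *v v) + v \<bullet> (E2 *v v)"]
      unfolding dot_square_norm by linarith
    have "(11 / 10 * N)\<^sup>2 = 121 / 100 * N\<^sup>2" by (simp add: power_mult_distrib power_divide)
    then have "(spectral_norm R)\<^sup>2 \<le> (11 / 10 * N)\<^sup>2"
      using R_norm zero_le_power2[of N] unfolding h_def by linarith
    then have R_le: "spectral_norm R \<le> 11 / 10 * N"
      by (rule power2_le_imp_le) (use N in simp)
    have "norm (Q ** R - X) \<le> 64 / 63 * (n\<^sup>2 * u * spectral_norm Q * spectral_norm R)"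
      using fl_row_solve_residual[OF Q(1)] nu by (simp add: assms(2) u_def)
    also have "\<dots> \<le> 64 / 63 * (n\<^sup>2 * u * spectral_norm Q * (11 / 10 * N))"
      using R_le u by (intro mult_left_mono) (auto simp: spectral_norm_nonneg)
    also have "\<dots> = 176 / 945 * ((6 * n\<^sup>2 * u * N) * spectral_norm Q)"
      by simp
    also have "\<dots> \<le> 176 / 945 * (\<sigma> * spectral_norm Q)"
      by (intro mult_left_mono mult_right_mono sigma_le spectral_norm_nonneg) simp
    also have "\<dots> \<le> 1 / 5 * (\<sigma> * spectral_norm Q)"
      using sigma spectral_norm_nonneg[of Q] by (intro mult_right_mono) auto
    finally show "norm (Q ** R - X) \<le> sigma_min X * spectral_norm Q / 5"
      by (simp add: \<sigma>_def)
  qed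
  moreover have "s / \<sigma>\<^sup>2 = \<alpha> * (real_of_ereal (cond2 X))\<^sup>2"
  proof -
    \<comment> \<open>\<open>sqrt\<close> is an odd function on the reals, so \<open>\<alpha>\<close> is positive because its root is\<close>
    have "0 < sqrt \<alpha>" using assms(7,10) N by (simp add: N_def)
    then have "\<alpha> = (sqrt \<alpha>)\<^sup>2" by simp
    also have "\<dots> = s / N\<^sup>2" unfolding assms(10) N_def using assms(7) by (simp add: power_divide)
    finally show ?thesis using N by (simp add: kappa power_divide)
  qed
  ultimately show ?thesis using Q(2) by auto
qed

end
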